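(* Let $(Q_{n,k})$ be a regular B-representable family of polynomials with orthogonal companion $Q^{\perp}_{n,k}=A_{n,k}(Q_{1,1},\ldots,Q_{n-k+1,1})$. Then for all integers $n\ge k\ge0$: (i) $Q^{\perp}_{n,n-k}=(-1)^k\sum_{j=0}^k\binom{k+n}{k-j}\binom{k-n}{k+j}(Q^{\perp}_{1,1})^{n+j}Q_{k+j,j}$; (ii) $Q_{n,n-k}=(-1)^k\sum_{j=0}^k\binom{k+n}{k-j}\binom{k-n}{k+j}(Q_{1,1})^{n+j}Q^{\perp}_{k+j,j}$.
   Context: $\mathbb{K}$ is a field of characteristic zero; binomial coefficients $\binom mj$ with integer $m$ and $j\ge0$ are $m(m-1)\cdots(m-j+1)/j!$. Partial Bell polynomials: $B_{0,0}=1$, $B_{n,0}=0$ ($n\ge1$), $B_{n,k}=0$ ($k>n$), and for $1\le k\le n$, $B_{n,k}=\sum\frac{n!}{\prod_ir_i!(i!)^{r_i}}\prod_iX_i^{r_i}$ over non-negative integers with $\sum r_i=k$, $\sum ir_i=n$. $A_{n,k}\in\mathbb{K}[X_1^{-1},X_1,X_2,\ldots]$ is the unique lower triangular family with $A_{0,0}=1$, $A_{n,0}=0$ ($n\ge1$) and $\sum_{j=k}^nA_{n,j}B_{j,k}=\delta_{nk}$. A family $(Q_{n,k})_{n,k\ge0}$ is B-representable if $Q_{n,k}=0$ for $k>n$, $Q_{0,0}=1$, $Q_{n,0}=0$ ($n\ge1$), and there exist polynomials $H_j$ with $Q_{n,k}=B_{n,k}(H_1,\ldots,H_{n-k+1})$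 for all $1\le k\le n$; it is regular if its finite lower triangular matrices are nonsingular. The same conventions for index $0$ hold for $Q^{\perp}$. *)

theory Defs
  imports
    "HOL-Library.Poly_Mapping"
    "HOL-Computational_Algebra.Polynomial_Factorial"
    "Jordan_Normal_Form.Determinant"
begin

text \<open>
  Laurent polynomials over \<open>'k\<close> in indeterminates indexed by \<open>nat\<close>: a monomial is a finitely
  supported map from indices to integer exponents, and index \<open>i\<close> stands for the indeterminate
  \<open>X\<^sub>i\<close>. The ring \<open>K[X\<^sub>1\<inverse>, X\<^sub>1, X\<^sub>2, \<dots>]\<close> is the subring \<open>poly_ring\<close>, in which \<open>X\<^sub>0\<close> does not
  occur and only \<open>X\<^sub>1\<close> may have negative exponents.
\<close>

type_synonym 'k laurent = "(nat \<Rightarrow>\<^sub>0 int) \<Rightarrow>\<^sub>0 'k"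

definition poly_ring :: "'k::field_char_0 laurent set" where
  "poly_ring = {p. \<forall>m\<in>Poly_Mapping.keys p.
     Poly_Mapping.lookup m 0 = 0 \<and> (\<forall>i\<ge>2. Poly_Mapping.lookup m i \<ge> 0)}"

definition const_laurent :: "'k::field_char_0 \<Rightarrow> 'k laurent" where
  "const_laurent c = Poly_Mapping.single 0 c"

definition indet :: "nat \<Rightarrow> 'k::field_char_0 laurent" where
  "indet i = Poly_Mapping.single (Poly_Mapping.single i 1) 1"

definition const_fract :: "'k::field_char_0 \<Rightarrow> 'k laurent fract" where
  "const_fract c = to_fract (const_laurent c)"

text \<open>
  \<open>laurent_subst h p\<close> is \<open>p(h\<^sub>1, h\<^sub>2, \<dots>)\<close>. Values are taken in the fraction field, because a substitution
  into \<open>X\<^sub>1\<inverse>\<close> need not stay inside \<open>poly_ring\<close>. On \<open>poly_ring\<close> it is a ring homomorphism as soon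
  as \<open>h 1 \<noteq> 0\<close>.
\<close>

definition laurent_subst :: "(nat \<Rightarrow> 'k laurent fract) \<Rightarrow> 'k::field_char_0 laurent \<Rightarrow> 'k laurent fract" where
  "laurent_subst h p = (\<Sum>m\<in>Poly_Mapping.keys p.
     const_fract (Poly_Mapping.lookup p m) *
     (\<Prod>i\<in>Poly_Mapping.keys m. h i powi Poly_Mapping.lookup m i))"

text \<open>
  The exponents \<open>r\<^sub>i\<close> with \<open>i > n\<close> vanish automatically when \<open>\<Sum>i r\<^sub>i = n\<close>; the support condition
  makes this explicit.
\<close>

definition bell_exponents :: "nat \<Rightarrow> nat \<Rightarrow> (nat \<Rightarrow> nat) set" where
  "bell_exponents n k = {r. (\<forall>i. i \<notin> {1..n} \<longrightarrow> r i = 0) \<and>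
     (\<Sum>i=1..n. r i) = k \<and> (\<Sum>i=1..n. i * r i) = n}"

definition bell_B :: "nat \<Rightarrow> nat \<Rightarrow> 'k::field_char_0 laurent" where
  "bell_B n k =
    (if k = 0 then (if n = 0 then 1 else 0)
     else if k > n then 0
     else \<Sum>r\<in>bell_exponents n k.
       const_laurent (fact n / (\<Prod>i=1..n. fact (r i) * fact i ^ r i)) * (\<Prod>i=1..n. indet i ^ r i))"

definition stirling_A :: "nat \<Rightarrow> nat \<Rightarrow> 'k::field_char_0 laurent" where
  "stirling_A = (THE A.
     (\<forall>n k. A n k \<in> poly_ring) \<and>
     (\<forall>n k. n < k \<longrightarrow> A n k = 0) \<and>
     A 0 0 = 1 \<and> (\<forall>n\<ge>1. A n 0 = 0) \<and>
     (\<forall>n k. (\<Sum>j=k..n. A n j * bell_B j k) = (if n = k then 1 else 0)))"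

definition B_representable :: "(nat \<Rightarrow> nat \<Rightarrow> 'k::field_char_0 laurent) \<Rightarrow> bool" where
  "B_representable Q \<longleftrightarrow>
     (\<forall>n k. Q n k \<in> poly_ring) \<and>
     (\<forall>n k. n < k \<longrightarrow> Q n k = 0) \<and>
     Q 0 0 = 1 \<and> (\<forall>n\<ge>1. Q n 0 = 0) \<and>
     (\<exists>H. (\<forall>j. H j \<in> poly_ring) \<and>
       (\<forall>n k. 1 \<le> k \<and> k \<le> n \<longrightarrow>
          to_fract (Q n k) = laurent_subst (\<lambda>j. to_fract (H j)) (bell_B n k)))"

definition regular_family :: "(nat \<Rightarrow> nat \<Rightarrow> 'k::field_char_0 laurent) \<Rightarrow> bool" where
  "regular_family Q \<longleftrightarrow> (\<forall>n. det (mat n n (\<lambda>(i, j). Q i j)) \<noteq> 0)"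

definition companion :: "(nat \<Rightarrow> nat \<Rightarrow> 'k::field_char_0 laurent) \<Rightarrow> nat \<Rightarrow> nat \<Rightarrow> 'k laurent fract" where
  "companion Q n k = laurent_subst (\<lambda>j. to_fract (Q j 1)) (stirling_A n k)"

end

theory Submission
  imports Defs "HOL-Computational_Algebra.Formal_Power_Series"
begin

text \<open>
  Let \<open>f = \<Sum>j\<ge>1. Q\<^sub>j\<^sub>,\<^sub>1 x\<^sup>j / j!\<close> and let \<open>g\<close> be its compositional inverse. Then \<open>Q\<^sub>n\<^sub>,\<^sub>k\<close> is
  \<open>n!/k!\<close> times the coefficient of \<open>x\<^sup>n\<close> in \<open>f\<^sup>k\<close>, and the companion is the same expression in \<open>g\<close>,
  because both are left inverses of the same triangular matrix. Write \<open>f = x p\<close>. Lagrange inversion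
  expresses the coefficients of \<open>g\<^sup>n\<^sup>-\<^sup>k\<close> by those of \<open>p\<^sup>-\<^sup>n\<close>; expanding \<open>p\<^sup>-\<^sup>n\<close> by the binomial
  series in \<open>p / Q\<^sub>1\<^sub>,\<^sub>1 - 1\<close> turns it into a combination of the powers \<open>p\<^sup>j\<close> with \<open>j \<le> k\<close>, which
  is (i). Interchanging \<open>f\<close> and \<open>g\<close> gives (ii).
\<close>

section \<open>Lagrange inversion\<close>

lemma fps_compose_mult_nth:
  fixes a b c :: "'a::comm_ring_1 fps"
  assumes "fps_nth b 0 = 0"
  shows "fps_nth ((a oo b) * c) n = (\<Sum>j=0..n. fps_nth a j * fps_nth (b ^ j * c) n)"
proof -
  have "fps_nth (a oo b) i = (\<Sum>j=0..n. fps_nth a j * fps_nth (b ^ j) i)" if "i \<le> n" for i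
    unfolding fps_compose_nth
    by (rule sum.mono_neutral_left) (use that assms in \<open>auto simp: startsby_zero_power_prefix\<close>)
  then have "fps_nth ((a oo b) * c) n
      = (\<Sum>i=0..n. \<Sum>j=0..n. fps_nth a j * fps_nth (b ^ j) i * fps_nth c (n - i))"
    by (simp add: fps_mult_nth sum_distrib_right)
  also have "\<dots> = (\<Sum>j=0..n. fps_nth a j * fps_nth (b ^ j * c) n)"
    by (subst sum.swap) (simp add: fps_mult_nth sum_distrib_left mult.assoc)
  finally show ?thesis .
qed

lemma fps_X_mult_deriv_nth: "fps_nth (fps_X * fps_deriv f) n = of_nat n * fps_nth f n"
  by (cases n) auto

lemma fps_X_mult_power_nth:
  fixes p :: "'a::comm_ring_1 fps"
  shows "fps_nth ((fps_X * p) ^ k) n = (if n < k then 0 else fps_nth (p ^ k) (n - k))"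
  by (simp add: power_mult_distrib fps_X_power_mult_nth)

text \<open>With \<open>f = x p\<close>, this is the formal residue of \<open>f' / f\<^sup>r\<^sup>+\<^sup>1\<close>.\<close>

lemma fps_deriv_mult_inverse_power_nth:
  fixes p :: "'a::field_char_0 fps"
  assumes p0: "fps_nth p 0 \<noteq> 0"
  shows "fps_nth (fps_deriv (fps_X * p) * inverse p ^ Suc r) r = (if r = 0 then 1 else 0)"
proof (cases r)
  case 0
  with p0 show ?thesis by simp
next
  case (Suc s)
  define q where "q = inverse p"
  have q_mult_p: "q * p = 1"
    unfolding q_def by (rule inverse_mult_eq_1[OF p0])
  have "fps_deriv q = - fps_deriv p * q\<^sup>2"
    unfolding q_def by (rule fps_inverse_deriv[OF p0])
  then have deriv_q_power: "fps_deriv (q ^ r) = - (of_nat r * fps_deriv p * q ^ Suc r)"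
    unfolding fps_deriv_power' Suc by (simp add: power2_eq_square mult_ac)
  have "fps_deriv (fps_X * p) * q ^ Suc r = q ^ r * (q * p) + fps_X * (fps_deriv p * q ^ Suc r)"
    by (simp add: algebra_simps)
  then have "of_nat r * (fps_deriv (fps_X * p) * q ^ Suc r)
      = of_nat r * q ^ r - fps_X * fps_deriv (q ^ r)"
    unfolding q_mult_p deriv_q_power by (simp add: algebra_simps)
  then have "of_nat r * fps_nth (fps_deriv (fps_X * p) * q ^ Suc r) r
      = of_nat r * fps_nth (q ^ r) r - fps_nth (fps_X * fps_deriv (q ^ r)) r"
    by (metis fps_mult_left_const_nth fps_of_nat fps_sub_nth)
  also have "\<dots> = 0"
    by (simp add: fps_X_mult_deriv_nth)
  finally show ?thesis
    using Suc by (simp add: q_def del: of_nat_Suc)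
qed

theorem fps_lagrange_buermann:
  fixes p u :: "'a::field_char_0 fps"
  assumes p0: "fps_nth p 0 \<noteq> 0"
  shows "fps_nth (fps_deriv (u oo fps_X * p) * inverse p ^ Suc n) n
    = of_nat (Suc n) * fps_nth u (Suc n)"
proof -
  let ?f = "fps_X * p" and ?q = "inverse p"
  define w where "w = fps_deriv ?f * ?q ^ Suc n"
  have f0: "fps_nth ?f 0 = 0"
    by simp
  have residue: "fps_nth (?f ^ j * w) n = (if j = n then 1 else 0)" if "j \<le> n" for j
  proof -
    have "p ^ j * ?q ^ Suc n = (?q * p) ^ j * ?q ^ Suc (n - j)"
      using that by (simp add: power_mult_distrib Suc_diff_le flip: power_add mult.assoc)
    then have "?f ^ j * w = fps_X ^ j * (fps_deriv ?f * ?q ^ Suc (n - j))"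
      unfolding w_def inverse_mult_eq_1[OF p0]
      by (simp only: power_mult_distrib power_one mult_1_left mult_ac)
    then show ?thesis
      using that by (simp only: fps_X_power_mult_nth fps_deriv_mult_inverse_power_nth[OF p0]) auto
  qed
  have "fps_deriv (u oo ?f) * ?q ^ Suc n = (fps_deriv u oo ?f) * w"
    by (simp add: w_def fps_compose_deriv mult.assoc)
  then have "fps_nth (fps_deriv (u oo ?f) * ?q ^ Suc n) n
      = (\<Sum>j=0..n. fps_nth (fps_deriv u) j * fps_nth (?f ^ j * w) n)"
    by (simp only: fps_compose_mult_nth[OF f0])
  also have "\<dots> = (\<Sum>j=0..n. if j = n then fps_nth (fps_deriv u) j else 0)"
    by (rule sum.cong) (simp_all add: residue)
  finally show ?thesis by simp
qed

corollary fps_lagrange_inversion: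
  fixes p g :: "'a::field_char_0 fps"
  assumes p0: "fps_nth p 0 \<noteq> 0" and inv: "g oo fps_X * p = fps_X" and "m \<le> n"
  shows "of_nat n * fps_nth (g ^ m) n = of_nat m * fps_nth (inverse p ^ n) (n - m)"
proof (cases "m = 0")
  case False
  with \<open>m \<le> n\<close> obtain i l where m: "m = Suc i" and n: "n = Suc l" and "i \<le> l"
    by (metis Suc_le_D Suc_le_mono not0_implies_Suc)
  have "g ^ m oo fps_X * p = fps_X ^ m"
    by (simp add: inv flip: fps_compose_power)
  then have "of_nat n * fps_nth (g ^ m) n = fps_nth (fps_deriv (fps_X ^ m) * inverse p ^ n) l"
    using fps_lagrange_buermann[OF p0, of "g ^ m" l] by (simp add: n)
  also have "fps_deriv (fps_X ^ m :: 'a fps) = fps_const (of_nat m) * fps_X ^ i"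
    by (simp only: fps_deriv_power fps_deriv_fps_X m mult_1_right diff_Suc_1)
  also have "fps_nth (\<dots> * inverse p ^ n) l = of_nat m * fps_nth (inverse p ^ n) (n - m)"
    using \<open>i \<le> l\<close> by (simp add: m n mult.assoc fps_X_power_mult_nth del: power_Suc)
  finally show ?thesis .
qed (cases "n = 0", simp_all)

section \<open>Negative powers of a power series\<close>

lemma gbinomial_alternating_sum:
  fixes c :: "'a::field_char_0"
  assumes "j \<le> k"
  shows "(\<Sum>i=j..k. (c gchoose i) * (of_nat (i choose j) * (-1) ^ (i - j)))
       = (c gchoose j) * (of_nat k - c gchoose (k - j))"
proof -
  have "(\<Sum>i=j..k. (c gchoose i) * (of_nat (i choose j) * (-1) ^ (i - j)))
      = (\<Sum>i=j..k. (c gchoose j) * ((c - of_nat j gchoose (i - j)) * (-1) ^ (i - j)))"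
    by (rule sum.cong)
      (auto simp: gbinomial_trinomial_revision mult.assoc[symmetric] binomial_gbinomial)
  also have "\<dots> = (c gchoose j) * (\<Sum>i\<le>k - j. (c - of_nat j gchoose i) * (-1) ^ i)"
    unfolding sum_distrib_left
    by (rule sum.reindex_bij_witness[of _ "\<lambda>i. i + j" "\<lambda>i. i - j"]) (use assms in auto)
  also have "(\<Sum>i\<le>k - j. (c - of_nat j gchoose i) * (-1) ^ i) = (of_nat k - c gchoose (k - j))"
    unfolding gbinomial_sum_lower_neg
    by (subst (2) gbinomial_negated_upper) (use assms in \<open>simp add: algebra_simps\<close>)
  finally show ?thesis .
qed

lemma fps_diff_1_power_nth:
  fixes p :: "'a::comm_ring_1 fps"
  shows "fps_nth ((p - 1) ^ i) k
    = (\<Sum>j\<le>i. of_nat (i choose j) * (-1) ^ (i - j) * fps_nth (p ^ j) k)"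
proof -
  have "(p - 1) ^ i = (\<Sum>j\<le>i. of_nat (i choose j) * p ^ j * (-1) ^ (i - j))"
    using binomial_ring[of p "-1" i] by simp
  also have "\<dots> = (\<Sum>j\<le>i. fps_const (of_nat (i choose j) * (-1) ^ (i - j)) * p ^ j)"
    by (simp add: fps_of_nat mult_ac flip: fps_const_mult fps_const_power fps_const_neg)
  finally show ?thesis
    by (simp add: fps_sum_nth)
qed

text \<open>
  For \<open>p\<close> with constant coefficient \<open>1\<close>, the coefficient of \<open>x\<^sup>k\<close> in \<open>p\<^sup>c\<close> is a polynomial of degree
  at most \<open>k\<close> in the exponent \<open>c\<close>; this is its Lagrange interpolation at the nodes \<open>0, \<dots>, k\<close>.
\<close>

lemma fps_binomial_compose_nth:
  fixes p :: "'a::field_char_0 fps"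
  shows "fps_nth (fps_binomial c oo (p - 1)) k
    = (\<Sum>j=0..k. (c gchoose j) * (of_nat k - c gchoose (k - j)) * fps_nth (p ^ j) k)"
proof -
  let ?t = "\<lambda>i j. (c gchoose i) * (of_nat (i choose j) * (-1) ^ (i - j)) * fps_nth (p ^ j) k"
  have "fps_nth (fps_binomial c oo (p - 1)) k = (\<Sum>i=0..k. \<Sum>j\<le>i. ?t i j)"
    by (simp add: fps_compose_nth fps_diff_1_power_nth sum_distrib_left mult_ac)
  also have "\<dots> = (\<Sum>i=0..k. \<Sum>j=0..k. ?t i j)"
    by (intro sum.cong sum.mono_neutral_left) auto
  also have "\<dots> = (\<Sum>j=0..k. \<Sum>i=j..k. ?t i j)"
    by (subst sum.swap) (intro sum.cong sum.mono_neutral_right; auto)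
  also have "\<dots> = (\<Sum>j=0..k. (c gchoose j) * (of_nat k - c gchoose (k - j)) * fps_nth (p ^ j) k)"
    by (rule sum.cong) (simp_all add: gbinomial_alternating_sum flip: sum_distrib_right)
  finally show ?thesis .
qed

lemma fps_binomial_minus_of_nat_compose:
  fixes p :: "'a::field_char_0 fps"
  assumes "fps_nth p 0 = 1"
  shows "fps_binomial (- of_nat n) oo (p - 1) = inverse p ^ n"
proof -
  have u0: "fps_nth (p - 1) 0 = 0"
    using assms by simp
  have "(1 + fps_X) oo (p - 1) = p"
    by (simp add: fps_compose_add_distrib fps_X_fps_compose_startby0[OF u0])
  then show ?thesis
    by (simp add: fps_binomial_minus_of_nat fps_inverse_compose[OF u0] fps_inverse_power
        flip: fps_compose_power[OF u0])
qed

lemma fps_inverse_power_nth: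
  fixes p :: "'a::field_char_0 fps"
  assumes p0: "fps_nth p 0 \<noteq> 0"
  shows "fps_nth (inverse p ^ n) k = (\<Sum>j=0..k. (- of_nat n gchoose j) *
    (of_nat k + of_nat n gchoose (k - j)) * inverse (fps_nth p 0) ^ (n + j) * fps_nth (p ^ j) k)"
proof -
  define b where "b = inverse (fps_nth p 0)"
  define q where "q = fps_const b * p"
  have q0: "fps_nth q 0 = 1"
    using p0 by (simp add: q_def b_def)
  have q_power: "fps_nth (q ^ j) k = b ^ j * fps_nth (p ^ j) k" for j
    by (simp add: q_def power_mult_distrib)
  have "inverse p = fps_const b * inverse q"
    using p0 by (simp add: q_def b_def fps_inverse_mult fps_const_inverse flip: mult.assoc)
  then have "fps_nth (inverse p ^ n) k = b ^ n * fps_nth (fps_binomial (- of_nat n) oo (q - 1)) k"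
    unfolding fps_binomial_minus_of_nat_compose[OF q0] by (simp add: power_mult_distrib)
  also have "\<dots> = (\<Sum>j=0..k. (- of_nat n gchoose j) *
      (of_nat k + of_nat n gchoose (k - j)) * b ^ (n + j) * fps_nth (p ^ j) k)"
    by (simp add: fps_binomial_compose_nth q_power sum_distrib_left power_add mult_ac)
  finally show ?thesis
    unfolding b_def .
qed

lemma pochhammer_diff_of_nat:
  assumes "k \<le> n"
  shows "of_nat n * fact (n - k) * pochhammer (of_nat (n - k)) k
    = (of_nat (n - k) * fact n :: 'a::field_char_0)"
proof -
  have "of_nat n * pochhammer (of_nat (n - k)) k = (pochhammer (of_nat (n - k)) (Suc k) :: 'a)"
    using assms by (simp add: pochhammer_rec' flip: of_nat_add)
  also have "\<dots> = of_nat (n - k) * pochhammer (1 + of_nat (n - k)) k"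
    by (simp add: pochhammer_rec add_ac)
  also have "fact (n - k) * \<dots> = of_nat (n - k) * fact n"
    using pochhammer_product[of "n - k" n "1 :: 'a"] assms by (simp add: pochhammer_fact mult_ac)
  finally show ?thesis
    by (simp add: mult_ac)
qed

lemma gbinomial_diff_of_nat:
  assumes "k \<le> n" and "n > 0"
  shows "(of_nat k - of_nat n gchoose (k + j)) = (-1) ^ k * (fact n * of_nat (n - k) * fact j /
      (fact (n - k) * of_nat n * fact (k + j))) * (- of_nat n gchoose j :: 'a::field_char_0)"
proof -
  have "pochhammer (of_nat (n - k)) (k + j)
      = (pochhammer (of_nat (n - k)) k * pochhammer (of_nat n) j :: 'a)"
    using assms by (simp add: pochhammer_product')
  also have "pochhammer (of_nat (n - k)) k
      = (fact n * of_nat (n - k) / (fact (n - k) * of_nat n) :: 'a)"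
    using pochhammer_diff_of_nat[OF \<open>k \<le> n\<close>, where 'a = 'a] \<open>n > 0\<close> by (simp add: field_simps)
  finally show ?thesis
    using assms by (simp add: gbinomial_pochhammer power_add mult_ac)
qed

section \<open>Iteration matrices\<close>

text \<open>
  For \<open>f = \<Sum>j\<ge>1. h\<^sub>j x\<^sup>j / j!\<close> this is Comtet's iteration matrix, with entries
  \<open>B\<^sub>n\<^sub>,\<^sub>k(h\<^sub>1, h\<^sub>2, \<dots>)\<close>.
\<close>

definition iteration_matrix :: "'a::field_char_0 fps \<Rightarrow> nat \<Rightarrow> nat \<Rightarrow> 'a" where
  "iteration_matrix f n k = fact n / fact k * fps_nth (f ^ k) n"

lemma iteration_matrix_0_right [simp]: "iteration_matrix f n 0 = (if n = 0 then 1 else 0)"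
  by (simp add: iteration_matrix_def)

lemma iteration_matrix_eq_0:
  assumes "fps_nth f 0 = 0" and "n < k"
  shows "iteration_matrix f n k = 0"
  using assms by (simp add: iteration_matrix_def startsby_zero_power_prefix)

lemma iteration_matrix_diag:
  assumes "fps_nth f 0 = 0"
  shows "iteration_matrix f n n = fps_nth f 1 ^ n"
  using assms by (simp add: iteration_matrix_def startsby_zero_power_nth_same)

lemma iteration_matrix_compose:
  assumes f0: "fps_nth f 0 = 0" and g0: "fps_nth g 0 = 0"
  shows "(\<Sum>j=k..n. iteration_matrix g n j * iteration_matrix f j k)
    = iteration_matrix (f oo g) n k"
proof -
  have "(\<Sum>j=k..n. iteration_matrix g n j * iteration_matrix f j k)
      = (\<Sum>j=0..n. iteration_matrix g n j * iteration_matrix f j k)"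
    by (rule sum.mono_neutral_left) (auto simp: iteration_matrix_eq_0[OF f0])
  also have "\<dots> = fact n / fact k * fps_nth (f ^ k oo g) n"
    by (simp add: iteration_matrix_def fps_compose_nth sum_distrib_left mult_ac)
  finally show ?thesis
    by (simp add: iteration_matrix_def fps_compose_power[OF g0])
qed

lemma iteration_matrix_fps_X: "iteration_matrix fps_X n k = (if n = k then 1 else 0)"
  by (simp add: iteration_matrix_def)

lemma iteration_matrix_fps_X_mult:
  "iteration_matrix (fps_X * p) (k + j) j = fact (k + j) / fact j * fps_nth (p ^ j) k"
  by (simp add: iteration_matrix_def fps_X_mult_power_nth)

lemma iteration_matrix_lagrange_inversion:
  fixes p g :: "'a::field_char_0 fps"
  assumes "fps_nth p 0 \<noteq> 0" and "g oo fps_X * p = fps_X" and "m \<le> n" and "n > 0"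
  shows "iteration_matrix g n m
    = fact n * of_nat m / (fact m * of_nat n) * fps_nth (inverse p ^ n) (n - m)"
  using fps_lagrange_inversion[OF assms(1-3)] \<open>n > 0\<close>
  by (simp add: iteration_matrix_def field_simps)

theorem iteration_matrix_compositional_inverse:
  fixes f g :: "'a::field_char_0 fps"
  assumes f0: "fps_nth f 0 = 0" and g0: "fps_nth g 0 = 0" and inv: "g oo f = fps_X" and "k \<le> n"
  shows "iteration_matrix g n (n - k) = (-1) ^ k * (\<Sum>j=0..k.
    (of_nat k + of_nat n gchoose (k - j)) * (of_nat k - of_nat n gchoose (k + j)) *
    iteration_matrix g 1 1 ^ (n + j) * iteration_matrix f (k + j) j)"
proof (cases "n = 0")
  case False
  define p where "p = fps_shift 1 f"
  have f: "f = fps_X * p"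
    unfolding p_def using f0 by (intro fps_ext) auto
  have "fps_nth p 0 * iteration_matrix g 1 1 = 1"
    using iteration_matrix_compose[OF g0 f0, of 1 1]
    by (simp add: inv iteration_matrix_fps_X iteration_matrix_diag f0 p_def)
  then have p0: "fps_nth p 0 \<noteq> 0" and g1: "inverse (fps_nth p 0) = iteration_matrix g 1 1"
    by (auto intro: inverse_unique)
  have "iteration_matrix g n (n - k)
      = fact n * of_nat (n - k) / (fact (n - k) * of_nat n) * fps_nth (inverse p ^ n) k"
    using iteration_matrix_lagrange_inversion[OF p0 inv[unfolded f], of "n - k" n] \<open>k \<le> n\<close> False
    by simp
  also have "\<dots> = (\<Sum>j=0..k. (-1) ^ k * ((of_nat k + of_nat n gchoose (k - j)) *
      (of_nat k - of_nat n gchoose (k + j)) * iteration_matrix g 1 1 ^ (n + j) *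
      iteration_matrix f (k + j) j))"
    unfolding fps_inverse_power_nth[OF p0] g1 f iteration_matrix_fps_X_mult sum_distrib_left
    using \<open>k \<le> n\<close> False
    by (simp add: gbinomial_diff_of_nat mult_ac flip: power_mult_distrib)
  finally show ?thesis
    unfolding sum_distrib_left .
qed (use \<open>k \<le> n\<close> in simp)

section \<open>Coefficients of powers of a power series\<close>

definition exponent_vectors :: "'i set \<Rightarrow> nat \<Rightarrow> ('i \<Rightarrow> nat) set" where
  "exponent_vectors I k = {r. (\<forall>i. i \<notin> I \<longrightarrow> r i = 0) \<and> sum r I = k}"

lemma exponent_vectors_empty: "exponent_vectors {} k = (if k = 0 then {\<lambda>_. 0} else {})"
  by (auto simp: exponent_vectors_def)

lemma finite_exponent_vectors:
  assumes "finite I"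
  shows "finite (exponent_vectors I k)"
proof (rule finite_subset)
  show "exponent_vectors I k \<subseteq> {r. \<forall>i. (i \<in> I \<longrightarrow> r i \<in> {..k}) \<and> (i \<notin> I \<longrightarrow> r i = 0)}"
    using assms by (auto simp: exponent_vectors_def intro!: member_le_sum)
  show "finite {r. \<forall>i. (i \<in> I \<longrightarrow> r i \<in> {..k}) \<and> (i \<notin> I \<longrightarrow> r i = 0)}"
    by (rule finite_set_of_finite_funs) (use assms in auto)
qed

lemma sum_if_eq_notin: "x \<notin> I \<Longrightarrow> (\<Sum>i\<in>I. if i = x then s else r i) = sum r I"
  by (intro sum.cong) auto

lemma sum_exponent_vectors_insert:
  assumes "finite I" "x \<notin> I"
  shows "(\<Sum>r\<in>exponent_vectors (insert x I) k. G r)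
    = (\<Sum>s\<le>k. \<Sum>r\<in>exponent_vectors I (k - s). G (r(x := s)))"
proof -
  have "(\<Sum>s\<le>k. \<Sum>r\<in>exponent_vectors I (k - s). G (r(x := s)))
     = (\<Sum>(s, r)\<in>Sigma {..k} (\<lambda>s. exponent_vectors I (k - s)). G (r(x := s)))"
    by (rule sum.Sigma) (auto simp: finite_exponent_vectors assms)
  also have "\<dots> = (\<Sum>r\<in>exponent_vectors (insert x I) k. G r)"
    by (rule sum.reindex_bij_witness[of _ "\<lambda>r. (r x, r(x := 0))" "\<lambda>(s, r). r(x := s)"])
      (use assms in \<open>auto simp: exponent_vectors_def fun_eq_iff sum_if_eq_notin\<close>)
  finally show ?thesis ..
qed

definition multinomial :: "'i set \<Rightarrow> ('i \<Rightarrow> nat) \<Rightarrow> nat" where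
  "multinomial I r = fact (sum r I) div (\<Prod>i\<in>I. fact (r i))"

lemma multinomial_cong: "(\<And>i. i \<in> I \<Longrightarrow> r i = r' i) \<Longrightarrow> multinomial I r = multinomial I r'"
  unfolding multinomial_def
  by (intro arg_cong2[where f = "(div)"] arg_cong[where f = fact] sum.cong prod.cong) auto

lemma prod_fact_dvd_fact_sum:
  assumes "finite I"
  shows "(\<Prod>i\<in>I. fact (r i)) dvd (fact (sum r I) :: nat)"
  using assms
proof induction
  case (insert x I)
  then have "(\<Prod>i\<in>insert x I. fact (r i)) dvd (fact (r x) * fact (sum r I) :: nat)"
    by (simp add: mult_dvd_mono)
  also have "\<dots> dvd fact (r x + sum r I)"
    by (rule fact_fact_dvd_fact)
  finally show ?case
    using insert by simp
qed simp

lemma of_nat_multinomial: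
  assumes "finite I"
  shows "of_nat (multinomial I r) = (fact (sum r I) / (\<Prod>i\<in>I. fact (r i)) :: 'a::field_char_0)"
proof -
  have "multinomial I r * (\<Prod>i\<in>I. fact (r i)) = fact (sum r I)"
    unfolding multinomial_def by (rule dvd_div_mult_self) (rule prod_fact_dvd_fact_sum[OF assms])
  then have "of_nat (multinomial I r * (\<Prod>i\<in>I. fact (r i))) = (of_nat (fact (sum r I)) :: 'a)"
    by (rule arg_cong)
  then show ?thesis
    using assms by (simp add: field_simps)
qed

lemma multinomial_insert:
  assumes "finite I" "x \<notin> I"
  shows "multinomial (insert x I) r = (sum r (insert x I) choose r x) * multinomial I r"
proof -
  have "of_nat (multinomial (insert x I) r)
      = (of_nat ((sum r (insert x I) choose r x) * multinomial I r) :: rat)"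
    using assms by (simp add: of_nat_multinomial binomial_fact)
  then show ?thesis
    by (simp only: of_nat_eq_iff)
qed

theorem multinomial_ring:
  fixes y :: "'i \<Rightarrow> 'a::comm_semiring_1"
  assumes "finite I"
  shows "(\<Sum>i\<in>I. y i) ^ k
    = (\<Sum>r\<in>exponent_vectors I k. of_nat (multinomial I r) * (\<Prod>i\<in>I. y i ^ r i))"
  using assms
proof (induction I arbitrary: k)
  case empty
  show ?case
    by (cases k) (simp_all add: exponent_vectors_empty multinomial_def)
next
  case (insert x I)
  let ?t = "\<lambda>r. of_nat (multinomial (insert x I) r) * (\<Prod>i\<in>insert x I. y i ^ r i)"
  have "(\<Sum>i\<in>insert x I. y i) ^ k
      = (\<Sum>s\<le>k. of_nat (k choose s) * y x ^ s * (\<Sum>i\<in>I. y i) ^ (k - s))"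
    using insert.hyps by (simp add: binomial_ring)
  also have "\<dots> = (\<Sum>s\<le>k. \<Sum>r\<in>exponent_vectors I (k - s). ?t (r(x := s)))"
  proof (rule sum.cong)
    fix s assume s: "s \<in> {..k}"
    have "of_nat (k choose s) * y x ^ s * (of_nat (multinomial I r) * (\<Prod>i\<in>I. y i ^ r i))
        = ?t (r(x := s))"
      if "r \<in> exponent_vectors I (k - s)" for r
    proof -
      have upd: "(r(x := s)) i = r i" if "i \<in> I" for i
        using that insert.hyps by auto
      have "sum (r(x := s)) (insert x I) = k"
        using \<open>r \<in> exponent_vectors I (k - s)\<close> insert.hyps s upd
        by (simp add: exponent_vectors_def cong: sum.cong)
      moreover have "multinomial I (r(x := s)) = multinomial I r"
        by (rule multinomial_cong) (rule upd)
      moreover have "(\<Prod>i\<in>I. y i ^ (r(x := s)) i) = (\<Prod>i\<in>I. y i ^ r i)"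
        by (intro prod.cong refl arg_cong2[where f = "(^)"] upd)
      ultimately show ?thesis
        using insert.hyps s by (simp add: multinomial_insert mult_ac del: sum.insert)
    qed
    then show "of_nat (k choose s) * y x ^ s * (\<Sum>i\<in>I. y i) ^ (k - s)
        = (\<Sum>r\<in>exponent_vectors I (k - s). ?t (r(x := s)))"
      unfolding insert.IH sum_distrib_left by (rule sum.cong[OF refl])
  qed simp
  also have "\<dots> = (\<Sum>r\<in>exponent_vectors (insert x I) k. ?t r)"
    by (rule sum_exponent_vectors_insert[symmetric]) (use insert.hyps in auto)
  finally show ?case .
qed

lemma fps_power_nth_cong:
  fixes f g :: "'a::comm_ring_1 fps"
  assumes "\<And>i. i \<le> n \<Longrightarrow> fps_nth f i = fps_nth g i"
  shows "fps_nth (f ^ k) n = fps_nth (g ^ k) n"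
  using assms
proof (induction k arbitrary: n)
  case (Suc k)
  have "fps_nth f i * fps_nth (f ^ k) (n - i) = fps_nth g i * fps_nth (g ^ k) (n - i)"
    if "i \<le> n" for i
    using Suc.prems[OF that] Suc.IH[of "n - i"] Suc.prems by simp
  then show ?case by (simp add: fps_mult_nth)
qed simp

lemma bell_exponents_eq:
  "bell_exponents n k = {r \<in> exponent_vectors {1..n} k. (\<Sum>i=1..n. i * r i) = n}"
  by (auto simp: bell_exponents_def exponent_vectors_def)

lemma fps_power_nth_bell_exponents:
  fixes f :: "'a::comm_ring_1 fps"
  assumes "fps_nth f 0 = 0"
  shows "fps_nth (f ^ k) n
    = (\<Sum>r\<in>bell_exponents n k. of_nat (multinomial {1..n} r) * (\<Prod>i=1..n. fps_nth f i ^ r i))"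
proof -
  let ?m = "\<lambda>i. fps_const (fps_nth f i) * fps_X ^ i"
  let ?c = "\<lambda>r. of_nat (multinomial {1..n} r) * (\<Prod>i=1..n. fps_nth f i ^ r i)"
  have monomial: "of_nat (multinomial {1..n} r) * (\<Prod>i=1..n. ?m i ^ r i)
      = fps_const (?c r) * fps_X ^ (\<Sum>i=1..n. i * r i)" for r
  proof -
    have "(\<Prod>i=1..n. fps_const (fps_nth f i) ^ r i) = fps_const (\<Prod>i=1..n. fps_nth f i ^ r i)"
      by (induction n) simp_all
    then show ?thesis
      by (simp add: power_mult_distrib prod.distrib power_sum fps_of_nat mult.assoc
          flip: power_mult fps_const_mult)
  qed
  have "fps_nth (f ^ k) n = fps_nth ((\<Sum>i=1..n. ?m i) ^ k) n"
  proof (rule fps_power_nth_cong)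
    show "fps_nth f j = fps_nth (\<Sum>i=1..n. ?m i) j" if "j \<le> n" for j
      using that assms by (cases j) (simp_all add: fps_sum_nth mult_delta_right)
  qed
  also have "\<dots> = (\<Sum>r\<in>exponent_vectors {1..n} k. if (\<Sum>i=1..n. i * r i) = n then ?c r else 0)"
    unfolding multinomial_ring[OF finite_atLeastAtMost] monomial fps_sum_nth
    by (intro sum.cong) auto
  also have "\<dots> = (\<Sum>r\<in>bell_exponents n k. ?c r)"
    unfolding bell_exponents_eq
    by (simp add: sum.inter_filter finite_exponent_vectors del: One_nat_def)
  finally show ?thesis .
qed

section \<open>The Laurent polynomial ring\<close>

lemma poly_mapping_eq_sum_single:
  fixes p :: "'a \<Rightarrow>\<^sub>0 'b::comm_monoid_add"
  shows "p = (\<Sum>m\<in>Poly_Mapping.keys p. Poly_Mapping.single m (Poly_Mapping.lookup p m))"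
  by (rule poly_mapping_eqI)
    (simp add: lookup_sum lookup_single when_def not_in_keys_iff_lookup_eq_zero)

lemma prod_single:
  "(\<Prod>x\<in>A. Poly_Mapping.single (m x) (1 :: 'a::comm_semiring_1))
    = Poly_Mapping.single (\<Sum>x\<in>A. m x) 1"
  by (induction A rule: infinite_finite_induct) (simp_all add: mult_single)

lemma indet_power: "indet i ^ e = Poly_Mapping.single (Poly_Mapping.single i (int e)) 1"
  by (induction e) (simp_all add: indet_def mult_single flip: single_add)

lemma poly_ringD:
  assumes "p \<in> poly_ring" "m \<in> Poly_Mapping.keys p"
  shows "Poly_Mapping.lookup m 0 = 0" "i \<noteq> 1 \<Longrightarrow> Poly_Mapping.lookup m i \<ge> 0"
  using assms by (cases "i = 0"; auto simp: poly_ring_def)+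

lemma poly_ring_0 [simp]: "0 \<in> poly_ring"
  by (simp add: poly_ring_def)

lemma poly_ring_single:
  "Poly_Mapping.lookup m 0 = 0 \<Longrightarrow> (\<And>i. i \<ge> 2 \<Longrightarrow> Poly_Mapping.lookup m i \<ge> 0) \<Longrightarrow>
    Poly_Mapping.single m c \<in> poly_ring"
  by (auto simp: poly_ring_def)

lemma poly_ring_1 [simp]: "1 \<in> poly_ring"
  using poly_ring_single[of 0 1] by simp

lemma poly_ring_add: "p \<in> poly_ring \<Longrightarrow> q \<in> poly_ring \<Longrightarrow> p + q \<in> poly_ring"
  using keys_add[of p q] by (force simp: poly_ring_def)

lemma poly_ring_diff: "p \<in> poly_ring \<Longrightarrow> q \<in> poly_ring \<Longrightarrow> p - q \<in> poly_ring"
  using keys_diff[of p q] by (force simp: poly_ring_def)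

lemma poly_ring_sum: "(\<And>x. x \<in> A \<Longrightarrow> f x \<in> poly_ring) \<Longrightarrow> sum f A \<in> poly_ring"
  by (induction A rule: infinite_finite_induct) (auto simp: poly_ring_add)

lemma poly_ring_mult:
  assumes "p \<in> poly_ring" "q \<in> poly_ring"
  shows "p * q \<in> poly_ring"
  unfolding poly_ring_def mem_Collect_eq
proof
  fix m assume "m \<in> Poly_Mapping.keys (p * q)"
  then obtain a b
    where "m = a + b" and a: "a \<in> Poly_Mapping.keys p" and b: "b \<in> Poly_Mapping.keys q"
    using keys_mult[of p q] by blast
  then show "Poly_Mapping.lookup m 0 = 0 \<and> (\<forall>i\<ge>2. Poly_Mapping.lookup m i \<ge> 0)"
    using poly_ringD[OF assms(1) a] poly_ringD[OF assms(2) b] by (simp add: lookup_add)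
qed

section \<open>Substitution into Laurent polynomials\<close>

interpretation to_fract: inj_idom_hom to_fract
  by unfold_locales simp_all

instance fract :: ("{idom,ring_char_0}") field_char_0
  by standard (simp add: inj_def flip: to_fract.hom_of_nat)

interpretation const_fract: field_hom const_fract
  by unfold_locales
    (simp_all add: const_fract_def const_laurent_def single_add mult_single
      flip: to_fract_add to_fract_mult)

lemma const_fract_fact: "const_fract (fact n) = fact n"
  using const_fract.hom_of_nat[of "fact n"] by simp

lemma const_fract_of_int_gchoose: "const_fract (of_int m gchoose k) = (of_int m gchoose k)"
  by (simp add: const_fract.hom_of_int flip: of_int_gbinomial)

lemma laurent_subst_superset:
  assumes "finite S" "Poly_Mapping.keys p \<subseteq> S"
  shows "laurent_subst h p = (\<Sum>m\<in>S. const_fract (Poly_Mapping.lookup p m) *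
     (\<Prod>i\<in>Poly_Mapping.keys m. h i powi Poly_Mapping.lookup m i))"
  unfolding laurent_subst_def
  by (rule sum.mono_neutral_left) (use assms in \<open>auto simp: not_in_keys_iff_lookup_eq_zero\<close>)

lemma laurent_subst_single:
  assumes "finite S" "Poly_Mapping.keys m \<subseteq> S"
  shows "laurent_subst h (Poly_Mapping.single m c) =
    const_fract c * (\<Prod>i\<in>S. h i powi Poly_Mapping.lookup m i)"
proof -
  have "laurent_subst h (Poly_Mapping.single m c) =
    const_fract c * (\<Prod>i\<in>Poly_Mapping.keys m. h i powi Poly_Mapping.lookup m i)"
    by (subst laurent_subst_superset[of "{m}"]) auto
  also have "(\<Prod>i\<in>Poly_Mapping.keys m. h i powi Poly_Mapping.lookup m i)
      = (\<Prod>i\<in>S. h i powi Poly_Mapping.lookup m i)"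
    by (rule prod.mono_neutral_left) (use assms in \<open>auto simp: not_in_keys_iff_lookup_eq_zero\<close>)
  finally show ?thesis .
qed

interpretation laurent_subst: comm_monoid_add_hom "laurent_subst h" for h
proof
  fix p q :: "'a laurent"
  let ?S = "Poly_Mapping.keys p \<union> Poly_Mapping.keys q"
  have "Poly_Mapping.keys (p + q) \<subseteq> ?S"
    by (rule keys_add)
  then show "laurent_subst h (p + q) = laurent_subst h p + laurent_subst h q"
    by (subst (1 2 3) laurent_subst_superset[of ?S])
      (auto simp: lookup_add const_fract.hom_add algebra_simps sum.distrib)
qed (simp add: laurent_subst_def)

lemma laurent_subst_1 [simp]: "laurent_subst h 1 = 1"
  by (simp add: laurent_subst_def)

lemma laurent_subst_mult_single:
  assumes "\<And>i. h i = 0 \<Longrightarrow> Poly_Mapping.lookup m i \<ge> 0 \<and> Poly_Mapping.lookup m' i \<ge> 0"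
  shows "laurent_subst h (Poly_Mapping.single m c * Poly_Mapping.single m' c')
    = laurent_subst h (Poly_Mapping.single m c) * laurent_subst h (Poly_Mapping.single m' c')"
proof -
  let ?S = "Poly_Mapping.keys m \<union> Poly_Mapping.keys m'"
  have "h i powi (Poly_Mapping.lookup m i + Poly_Mapping.lookup m' i)
      = h i powi Poly_Mapping.lookup m i * h i powi Poly_Mapping.lookup m' i" for i
    using assms[of i]
    by (cases "Poly_Mapping.lookup m i = 0 \<and> Poly_Mapping.lookup m' i = 0")
      (auto intro!: power_int_add)
  moreover have "Poly_Mapping.keys (m + m') \<subseteq> ?S"
    by (rule keys_add)
  ultimately show ?thesis
    unfolding mult_single
    by (subst (1 2 3) laurent_subst_single[of ?S])
      (auto simp: const_fract.hom_mult lookup_add prod.distrib)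
qed

lemma laurent_subst_mult:
  assumes p: "p \<in> poly_ring" and q: "q \<in> poly_ring" and h1: "h 1 \<noteq> 0"
  shows "laurent_subst h (p * q) = laurent_subst h p * laurent_subst h q"
proof -
  let ?P = "\<lambda>m. Poly_Mapping.single m (Poly_Mapping.lookup p m)"
  let ?Q = "\<lambda>m. Poly_Mapping.single m (Poly_Mapping.lookup q m)"
  have "laurent_subst h (?P m * ?Q m') = laurent_subst h (?P m) * laurent_subst h (?Q m')"
    if "m \<in> Poly_Mapping.keys p" "m' \<in> Poly_Mapping.keys q" for m m'
  proof (rule laurent_subst_mult_single)
    fix i assume "h i = 0"
    with h1 have "i \<noteq> 1"
      by auto
    with p q that show "Poly_Mapping.lookup m i \<ge> 0 \<and> Poly_Mapping.lookup m' i \<ge> 0"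
      by (auto intro: poly_ringD)
  qed
  then have "laurent_subst h (sum ?P (Poly_Mapping.keys p) * sum ?Q (Poly_Mapping.keys q))
      = laurent_subst h (sum ?P (Poly_Mapping.keys p)) *
        laurent_subst h (sum ?Q (Poly_Mapping.keys q))"
    by (simp add: sum_product laurent_subst.hom_sum)
  then show ?thesis
    by (simp flip: poly_mapping_eq_sum_single)
qed

lemma to_fract_indet_power_int:
  "to_fract (indet i :: 'k::field_char_0 laurent) powi e
    = to_fract (Poly_Mapping.single (Poly_Mapping.single i e) 1)"
proof (cases "e \<ge> 0")
  case True
  then show ?thesis
    by (simp add: power_int_def indet_power flip: to_fract.hom_power)
next
  case False
  let ?X = "\<lambda>e. Poly_Mapping.single (Poly_Mapping.single i e) 1 :: 'k laurent"
  have "?X (- e) * ?X e = 1"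
    by (simp add: mult_single flip: single_add)
  then have "to_fract (?X (- e)) * to_fract (?X e) = 1"
    by (simp flip: to_fract_mult)
  then have "inverse (to_fract (?X (- e))) = to_fract (?X e)"
    by (rule inverse_unique)
  then show ?thesis
    using False by (simp add: power_int_def power_inverse indet_power flip: to_fract.hom_power)
qed

lemma laurent_subst_indet_single:
  "laurent_subst (\<lambda>i. to_fract (indet i)) (Poly_Mapping.single m c)
    = to_fract (Poly_Mapping.single m c)"
proof -
  let ?X = "\<lambda>i. Poly_Mapping.single (Poly_Mapping.single i (Poly_Mapping.lookup m i)) 1"
  have "laurent_subst (\<lambda>i. to_fract (indet i)) (Poly_Mapping.single m c)
      = to_fract (const_laurent c * (\<Prod>i\<in>Poly_Mapping.keys m. ?X i))"
    by (simp add: laurent_subst_single[of "Poly_Mapping.keys m"] const_fract_def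
        to_fract_indet_power_int to_fract.hom_prod)
  then show ?thesis
    by (simp add: prod_single const_laurent_def mult_single flip: poly_mapping_eq_sum_single)
qed

lemma laurent_subst_indet: "laurent_subst (\<lambda>i. to_fract (indet i)) p = to_fract p"
  by (subst (1 2) poly_mapping_eq_sum_single[of p])
    (simp add: laurent_subst.hom_sum laurent_subst_indet_single)

section \<open>Bell polynomials as entries of iteration matrices\<close>

text \<open>The value \<open>h 0\<close> is ignored: the index \<open>0\<close> stands for no indeterminate.\<close>

definition egf :: "(nat \<Rightarrow> 'a::field_char_0) \<Rightarrow> 'a fps" where
  "egf h = Abs_fps (\<lambda>i. if i = 0 then 0 else h i / fact i)"

lemma egf_nth_0 [simp]: "fps_nth (egf h) 0 = 0"
  by (simp add: egf_def)

lemma egf_nth_1 [simp]: "fps_nth (egf h) (Suc 0) = h 1"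
  by (simp add: egf_def)

lemma egf_cong: "(\<And>i. i \<ge> 1 \<Longrightarrow> h i = h' i) \<Longrightarrow> egf h = egf h'"
  by (simp add: egf_def fps_eq_iff)

lemma iteration_matrix_egf_1: "n \<ge> 1 \<Longrightarrow> iteration_matrix (egf h) n 1 = h n"
  by (simp add: iteration_matrix_def egf_def)

lemma iteration_matrix_egf:
  "iteration_matrix (egf h) n k = (\<Sum>r\<in>bell_exponents n k.
    fact n / (\<Prod>i=1..n. fact (r i) * fact i ^ r i) * (\<Prod>i=1..n. h i ^ r i))"
  unfolding iteration_matrix_def fps_power_nth_bell_exponents[OF egf_nth_0] sum_distrib_left
proof (rule sum.cong)
  fix r assume "r \<in> bell_exponents n k"
  then have "sum r {1..n} = k"
    by (simp add: bell_exponents_def)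
  then have "of_nat (multinomial {1..n} r) = (fact k / (\<Prod>i=1..n. fact (r i)) :: 'a)"
    by (subst of_nat_multinomial) simp_all
  moreover have "(\<Prod>i=1..n. fps_nth (egf h) i ^ r i)
      = (\<Prod>i=1..n. h i ^ r i) / (\<Prod>i=1..n. fact i ^ r i)"
    unfolding prod_dividef[symmetric] by (rule prod.cong) (auto simp: egf_def power_divide)
  ultimately show "fact n / fact k *
      (of_nat (multinomial {1..n} r) * (\<Prod>i=1..n. fps_nth (egf h) i ^ r i))
      = fact n / (\<Prod>i=1..n. fact (r i) * fact i ^ r i) * (\<Prod>i=1..n. h i ^ r i)"
    by (simp add: prod.distrib)
qed simp

definition bell_monom :: "nat \<Rightarrow> (nat \<Rightarrow> nat) \<Rightarrow> (nat \<Rightarrow>\<^sub>0 int)" where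
  "bell_monom n r = (\<Sum>i=1..n. Poly_Mapping.single i (int (r i)))"

lemma lookup_bell_monom:
  "Poly_Mapping.lookup (bell_monom n r) i = (if i \<in> {1..n} then int (r i) else 0)"
  by (simp add: bell_monom_def lookup_sum lookup_single when_def)

lemma keys_bell_monom: "Poly_Mapping.keys (bell_monom n r) \<subseteq> {1..n}"
  by (auto simp: in_keys_iff lookup_bell_monom split: if_splits)

lemma laurent_subst_single_bell_monom:
  "laurent_subst h (Poly_Mapping.single (bell_monom n r) c) = const_fract c * (\<Prod>i=1..n. h i ^ r i)"
  unfolding laurent_subst_single[OF finite_atLeastAtMost keys_bell_monom]
  by (intro arg_cong2[where f = "(*)"] prod.cong refl) (simp add: lookup_bell_monom)

lemma bell_exponents_0_right: "bell_exponents n 0 = (if n = 0 then {\<lambda>_. 0} else {})"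
  by (auto simp: bell_exponents_def)

lemma bell_exponents_eq_empty:
  assumes "n < k"
  shows "bell_exponents n k = {}"
proof -
  have "k \<le> n" if "r \<in> bell_exponents n k" for r
    using sum_mono[of "{1..n}" r "\<lambda>i. i * r i"] that by (auto simp: bell_exponents_def)
  with assms show ?thesis
    by fastforce
qed

lemma bell_B_0_right: "bell_B n 0 = (if n = 0 then 1 else 0)"
  by (simp add: bell_B_def)

lemma bell_B_altdef:
  "bell_B n k = (\<Sum>r\<in>bell_exponents n k. Poly_Mapping.single (bell_monom n r)
    (fact n / (\<Prod>i=1..n. fact (r i) * fact i ^ r i)))"
proof -
  have "const_laurent c * (\<Prod>i=1..n. indet i ^ r i) = Poly_Mapping.single (bell_monom n r) c"
    for c :: 'a and r
    by (simp add: indet_power prod_single const_laurent_def mult_single bell_monom_def)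
  then show ?thesis
    by (simp add: bell_B_def bell_exponents_0_right bell_exponents_eq_empty bell_monom_def)
qed

lemma bell_B_in_poly_ring: "bell_B n k \<in> poly_ring"
  unfolding bell_B_altdef by (auto intro!: poly_ring_sum poly_ring_single simp: lookup_bell_monom)

theorem laurent_subst_bell_B: "laurent_subst h (bell_B n k) = iteration_matrix (egf h) n k"
  unfolding bell_B_altdef iteration_matrix_egf
  by (simp add: laurent_subst.hom_sum laurent_subst_single_bell_monom const_fract.hom_div
      const_fract.hom_prod const_fract.hom_mult const_fract.hom_power const_fract_fact)

lemma bell_B_diag: "bell_B n n = indet 1 ^ n"
proof -
  have "to_fract (bell_B n n) = iteration_matrix (egf (\<lambda>i. to_fract (indet i))) n n"
    by (simp add: laurent_subst_indet flip: laurent_subst_bell_B)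
  then show ?thesis
    by (simp add: iteration_matrix_diag flip: to_fract.hom_power)
qed

section \<open>The inverse of the Bell matrix\<close>

lemma lower_triangular_row_unique:
  fixes B :: "nat \<Rightarrow> nat \<Rightarrow> 'a::idom"
  assumes diag: "\<And>k. k \<le> n \<Longrightarrow> B k k \<noteq> 0"
    and eq: "\<And>k. k \<le> n \<Longrightarrow> (\<Sum>j=k..n. a j * B j k) = (\<Sum>j=k..n. b j * B j k)"
    and "k \<le> n"
  shows "a k = b k"
  using \<open>k \<le> n\<close>
proof (induction "n - k" arbitrary: k rule: less_induct)
  case less
  have "(\<Sum>j=Suc k..n. a j * B j k) = (\<Sum>j=Suc k..n. b j * B j k)"
    using less by (intro sum.cong) auto
  then have "a k * B k k = b k * B k k"
    using eq[OF less.prems] less.prems by (simp add: sum.atLeast_Suc_atMost)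
  then show ?case
    using diag[OF less.prems] by simp
qed

text \<open>The argument \<open>u\<close> lists inverses of the diagonal entries of \<open>B\<close>.\<close>

function lower_triangular_inverse ::
  "(nat \<Rightarrow> nat \<Rightarrow> 'a::comm_ring_1) \<Rightarrow> (nat \<Rightarrow> 'a) \<Rightarrow> nat \<Rightarrow> nat \<Rightarrow> 'a"
where
  "lower_triangular_inverse B u n k =
    ((if n = k then 1 else 0) - (\<Sum>j=Suc k..n. lower_triangular_inverse B u n j * B j k)) * u k"
  by auto
termination
  by (relation "measure (\<lambda>(B, u, n, k). n - k)") auto

declare lower_triangular_inverse.simps [simp del]

lemma lower_triangular_inverse_eq_0: "n < k \<Longrightarrow> lower_triangular_inverse B u n k = 0"
  by (subst lower_triangular_inverse.simps) simp

lemma lower_triangular_inverse_left: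
  assumes "u k * B k k = 1"
  shows "(\<Sum>j=k..n. lower_triangular_inverse B u n j * B j k) = (if n = k then 1 else 0)"
proof (cases "k \<le> n")
  case True
  then show ?thesis
    using assms lower_triangular_inverse.simps[of B u n k]
    by (simp add: sum.atLeast_Suc_atMost mult.assoc)
qed simp

lemma lower_triangular_inverse_closed:
  assumes "0 \<in> R" and "1 \<in> R"
    and add: "\<And>x y. x \<in> R \<Longrightarrow> y \<in> R \<Longrightarrow> x + y \<in> R"
    and diff: "\<And>x y. x \<in> R \<Longrightarrow> y \<in> R \<Longrightarrow> x - y \<in> R"
    and mult: "\<And>x y. x \<in> R \<Longrightarrow> y \<in> R \<Longrightarrow> x * y \<in> R"
    and B: "\<And>j k. B j k \<in> R" and u: "\<And>k. u k \<in> R"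
  shows "lower_triangular_inverse B u n k \<in> R"
proof (induction "n - k" arbitrary: k rule: less_induct)
  case less
  have sum_closed: "sum f J \<in> R" if "\<And>j. j \<in> J \<Longrightarrow> f j \<in> R" for f and J :: "nat set"
    using that by (induction J rule: infinite_finite_induct) (auto simp: \<open>0 \<in> R\<close> add)
  have "(\<Sum>j=Suc k..n. lower_triangular_inverse B u n j * B j k) \<in> R"
    by (intro sum_closed mult less B) auto
  then show ?case
    by (subst lower_triangular_inverse.simps) (simp add: assms)
qed

definition bell_diag_inverse :: "nat \<Rightarrow> 'k::field_char_0 laurent" where
  "bell_diag_inverse k = Poly_Mapping.single (Poly_Mapping.single 1 (- int k)) 1"

lemma bell_diag_inverse_left: "bell_diag_inverse k * bell_B k k = 1"
  by (simp add: bell_diag_inverse_def bell_B_diag indet_power mult_single flip: single_add)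

lemma bell_diag_inverse_in_poly_ring: "bell_diag_inverse k \<in> poly_ring"
  unfolding bell_diag_inverse_def by (rule poly_ring_single) (auto simp: lookup_single when_def)

lemma lower_triangular_inverse_bell_B_in_poly_ring:
  "lower_triangular_inverse bell_B bell_diag_inverse n k \<in> poly_ring"
  by (rule lower_triangular_inverse_closed)
    (simp_all add: poly_ring_add poly_ring_diff poly_ring_mult bell_B_in_poly_ring
      bell_diag_inverse_in_poly_ring)

lemma stirling_A_eq_lower_triangular_inverse:
  "stirling_A = (lower_triangular_inverse bell_B bell_diag_inverse
    :: nat \<Rightarrow> nat \<Rightarrow> 'k::field_char_0 laurent)"
  unfolding stirling_A_def
proof (rule the_equality, goal_cases existence uniqueness)
  case existence
  let ?A = "lower_triangular_inverse bell_B bell_diag_inverse :: nat \<Rightarrow> nat \<Rightarrow> 'k laurent"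
  have left_inverse: "(\<Sum>j=k..n. ?A n j * bell_B j k) = (if n = k then 1 else 0)" for n k
    by (rule lower_triangular_inverse_left) (rule bell_diag_inverse_left)
  have "?A n 0 = (\<Sum>j=0..n. ?A n j * bell_B j 0)" for n
    by (simp add: bell_B_0_right mult_delta_right)
  then have "?A n 0 = (if n = 0 then 1 else 0)" for n
    by (simp only: left_inverse)
  then show ?case
    by (simp add: left_inverse lower_triangular_inverse_eq_0
        lower_triangular_inverse_bell_B_in_poly_ring)
next
  case (uniqueness A)
  show ?case
  proof (intro ext)
    fix n k
    have nonzero: "bell_B i i \<noteq> (0 :: 'k laurent)" for i
      using bell_diag_inverse_left[of i, where 'a = 'k] by auto
    show "A n k = lower_triangular_inverse bell_B bell_diag_inverse n k"
    proof (cases "k \<le> n")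
      case True
      then show ?thesis
        by (rule lower_triangular_row_unique[rotated 2, where B = bell_B])
          (use uniqueness nonzero in
            \<open>simp_all add: lower_triangular_inverse_left bell_diag_inverse_left\<close>)
    qed (use uniqueness in \<open>simp add: lower_triangular_inverse_eq_0\<close>)
  qed
qed

lemma stirling_A_in_poly_ring: "stirling_A n k \<in> poly_ring"
  by (simp add: stirling_A_eq_lower_triangular_inverse
      lower_triangular_inverse_bell_B_in_poly_ring)

lemma stirling_A_eq_0: "n < k \<Longrightarrow> stirling_A n k = 0"
  by (simp add: stirling_A_eq_lower_triangular_inverse lower_triangular_inverse_eq_0)

lemma stirling_A_bell_B: "(\<Sum>j=k..n. stirling_A n j * bell_B j k) = (if n = k then 1 else 0)"
  by (simp add: stirling_A_eq_lower_triangular_inverse lower_triangular_inverse_left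
      bell_diag_inverse_left)

section \<open>Representable families\<close>

lemma B_representable_eq_iteration_matrix:
  assumes "B_representable Q"
  shows "to_fract (Q n k) = iteration_matrix (egf (\<lambda>j. to_fract (Q j 1))) n k"
proof -
  from assms obtain H where H: "\<And>n k. 1 \<le> k \<Longrightarrow> k \<le> n \<Longrightarrow>
      to_fract (Q n k) = iteration_matrix (egf (\<lambda>j. to_fract (H j))) n k"
    and Q: "\<And>n k. n < k \<Longrightarrow> Q n k = 0" "Q 0 0 = 1" "\<And>n. n \<ge> 1 \<Longrightarrow> Q n 0 = 0"
    unfolding B_representable_def laurent_subst_bell_B by blast
  have "to_fract (Q j 1) = to_fract (H j)" if "j \<ge> 1" for j
    using H[of 1 j] that by (simp only: iteration_matrix_egf_1)
  then have egf: "egf (\<lambda>j. to_fract (Q j 1)) = egf (\<lambda>j. to_fract (H j))"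
    by (rule egf_cong)
  consider "k = 0" | "n < k" | "1 \<le> k" "k \<le> n"
    by linarith
  then show ?thesis
    by cases (auto simp: egf H Q iteration_matrix_eq_0 simp del: One_nat_def)
qed

lemma regular_family_diag_nonzero:
  assumes "B_representable Q" "regular_family Q"
  shows "Q n n \<noteq> 0"
proof -
  let ?M = "mat (Suc n) (Suc n) (\<lambda>(i, j). Q i j)"
  have "det ?M = prod_list (diag_mat ?M)"
    by (rule det_lower_triangular[where n = "Suc n"])
      (use assms(1) in \<open>auto simp: B_representable_def\<close>)
  moreover have "det ?M \<noteq> 0"
    using assms(2) unfolding regular_family_def by blast
  moreover have "Q n n \<in> set (diag_mat ?M)"
    by (auto simp: diag_mat_def)
  ultimately show ?thesis
    by auto
qed

lemma companion_eq_iteration_matrix: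
  assumes "Q 1 1 \<noteq> 0"
  shows "companion Q n k = iteration_matrix (fps_inv (egf (\<lambda>j. to_fract (Q j 1)))) n k"
proof -
  define h where "h = (\<lambda>j. to_fract (Q j 1))"
  have f1: "fps_nth (egf h) 1 \<noteq> 0"
    using assms by (simp add: h_def)
  have g0: "fps_nth (fps_inv (egf h)) 0 = 0"
    by (simp add: fps_inv_def)
  have "companion Q n k = iteration_matrix (fps_inv (egf h)) n k"
  proof (cases "k \<le> n")
    case True
    show ?thesis
    proof (rule lower_triangular_row_unique[where B = "iteration_matrix (egf h)", OF _ _ True])
      show "iteration_matrix (egf h) i i \<noteq> 0" for i
        using f1 by (simp add: iteration_matrix_diag)
      fix i
      have "(\<Sum>j=i..n. companion Q n j * iteration_matrix (egf h) j i)
         = laurent_subst h (\<Sum>j=i..n. stirling_A n j * bell_B j i)"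
        using f1 by (simp add: laurent_subst.hom_sum companion_def h_def laurent_subst_mult
            stirling_A_in_poly_ring bell_B_in_poly_ring laurent_subst_bell_B)
      also have "\<dots> = iteration_matrix (egf h oo fps_inv (egf h)) n i"
        using f1 by (simp add: stirling_A_bell_B fps_inv_right iteration_matrix_fps_X)
      finally show "(\<Sum>j=i..n. companion Q n j * iteration_matrix (egf h) j i)
          = (\<Sum>j=i..n. iteration_matrix (fps_inv (egf h)) n j * iteration_matrix (egf h) j i)"
        by (simp add: iteration_matrix_compose g0)
    qed
  qed (simp add: companion_def stirling_A_eq_0 iteration_matrix_eq_0 g0)
  then show ?thesis
    by (simp add: h_def)
qed

theorem theorem5p7:
  fixes Q :: "nat \<Rightarrow> nat \<Rightarrow> 'k::field_char_0 laurent" and n k :: nat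
  assumes "B_representable Q" and "regular_family Q" and "k \<le> n"
  shows "companion Q n (n - k) =
      (-1) ^ k * (\<Sum>j=0..k. const_fract (of_int (int k + int n) gchoose (k - j)) *
        const_fract (of_int (int k - int n) gchoose (k + j)) *
        companion Q 1 1 ^ (n + j) * to_fract (Q (k + j) j)) \<and>
    to_fract (Q n (n - k)) =
      (-1) ^ k * (\<Sum>j=0..k. const_fract (of_int (int k + int n) gchoose (k - j)) *
        const_fract (of_int (int k - int n) gchoose (k + j)) *
        to_fract (Q 1 1) ^ (n + j) * companion Q (k + j) j)"
proof -
  define f where "f = egf (\<lambda>j. to_fract (Q j 1))"
  define g where "g = fps_inv f"
  have "Q 1 1 \<noteq> 0"
    by (rule regular_family_diag_nonzero) (fact assms)+
  then have companion: "companion Q i j = iteration_matrix g i j" for i j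
    unfolding g_def f_def by (rule companion_eq_iteration_matrix)
  have Q: "to_fract (Q i j) = iteration_matrix f i j" for i j
    unfolding f_def by (rule B_representable_eq_iteration_matrix[OF assms(1)])
  have f0: "fps_nth f 0 = 0" and g0: "fps_nth g 0 = 0" and f1: "fps_nth f 1 \<noteq> 0"
    using \<open>Q 1 1 \<noteq> 0\<close> by (simp_all add: f_def g_def fps_inv_def)
  have "g oo f = fps_X" and "f oo g = fps_X"
    unfolding g_def by (rule fps_inv[OF f0 f1], rule fps_inv_right[OF f0 f1])
  then show ?thesis
    unfolding const_fract_of_int_gchoose companion Q
    using iteration_matrix_compositional_inverse[OF f0 g0 _ \<open>k \<le> n\<close>]
      iteration_matrix_compositional_inverse[OF g0 f0 _ \<open>k \<le> n\<close>]
    by simp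
qed

end
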